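(* Let $\mu\in\mathbb C$ with $2\mu+1\notin\{0,-1,-2,\ldots\}$, and let $n\ge1$ be an integer. Then for all $x,x'\in(-1,1)$ with $x\ne x'$, $$\sum_{k=0}^{n-1}\frac{(2\mu+2k+1)\,\Gamma(2\mu+k+1)}{k!}\,{\sf P}_{k+\mu}^{-\mu}(x)\,{\sf P}_{k+\mu}^{-\mu}(x')=\frac{\Gamma(2\mu+n+1)}{(n-1)!\,(x-x')}\left({\sf P}_{n+\mu}^{-\mu}(x)\,{\sf P}_{n+\mu-1}^{-\mu}(x')-{\sf P}_{n+\mu-1}^{-\mu}(x)\,{\sf P}_{n+\mu}^{-\mu}(x')\right),$$ and for all $x\in(-1,1)$, $$\sum_{k=0}^{n-1}\frac{(2\mu+2k+1)\,\Gamma(2\mu+k+1)}{k!}\left({\sf P}_{k+\mu}^{-\mu}(x)\right)^2=\frac{\Gamma(2\mu+n+1)}{(n-1)!\,(1-x^2)}\Big((n+2\mu)\left({\sf P}_{n+\mu}^{-\mu}(x)\right)^2+n\left({\sf P}_{n+\mu-1}^{-\mu}(x)\right)^2-2x(n+\mu)\,{\sf P}_{n+\mu-1}^{-\mu}(x)\,{\sf P}_{n+\mu}^{-\mu}(x)\Big).$$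
   Context: The Ferrers function of the first kind is, for $\nu,\mu\in\mathbb C$ and $x\in(-1,1)$, $${\sf P}_\nu^{-\mu}(x)=\frac{1}{\Gamma(\mu+1)}\left(\frac{1-x}{1+x}\right)^{\frac{\mu}{2}}{}_2F_1\left(-\nu,\nu+1;\mu+1;\frac{1-x}{2}\right)=\left(\frac{1-x}{1+x}\right)^{\frac{\mu}{2}}\sum_{j=0}^\infty\frac{(-\nu)_j(\nu+1)_j}{\Gamma(\mu+1+j)\,j!}\left(\frac{1-x}{2}\right)^j,$$ where $(a)_0=1$, $(a)_j=a(a+1)\cdots(a+j-1)$ and $1/\Gamma$ is the entire reciprocal gamma function. *)

theory Defs
  imports "HOL-Analysis.Analysis"
begin

text \<open>
  The order enters with a minus sign: \<open>ferrers_P_neg \<nu> \<mu> x\<close> is the Ferrers function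
  of the first kind of degree \<open>\<nu>\<close> and order \<open>-\<mu>\<close>, for \<open>-1 < x < 1\<close>. The base of the
  complex power is then a positive real, so the principal branch is the usual power. The factor
  \<^const>\<open>rGamma\<close> (entire) keeps the series meaningful when \<open>\<mu> + 1\<close> is a pole of \<^const>\<open>Gamma\<close>.
\<close>

definition ferrers_P_neg :: "complex \<Rightarrow> complex \<Rightarrow> real \<Rightarrow> complex" where
  "ferrers_P_neg \<nu> \<mu> x =
     complex_of_real ((1 - x) / (1 + x)) powr (\<mu> / 2) *
     (\<Sum>j. pochhammer (- \<nu>) j * pochhammer (\<nu> + 1) j * rGamma (\<mu> + 1 + of_nat j) / fact j *
           complex_of_real ((1 - x) / 2) ^ j)"

end

theory Submission
  imports Defs
begin

text \<open>
  Write \<open>P k\<close> for the Ferrers function of degree \<open>k + \<mu>\<close> and order \<open>-\<mu>\<close>. Everything follows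
  from the three-term recurrence
  \<open>(k + 2\<mu> + 1) P (k+1) = (2k + 2\<mu> + 1) x P k - k P (k-1)\<close>,
  the case \<open>\<nu> = k + \<mu>\<close> of \<open>ferrers_P_neg_recurrence\<close>. That recurrence is a contiguous relation for
  hypergeometric series: with \<open>x = 1 - 2t\<close> it holds coefficientwise in powers of \<open>t\<close>
  (\<open>ferrers_coeff_recurrence\<close>), and the series converge for \<open>\<bar>t\<bar> < 1\<close>.

  The weights \<open>w k = \<Gamma>(2\<mu> + k + 1) / k!\<close> satisfy \<open>(k + 1) w (k+1) = (k + 2\<mu> + 1) w k\<close>, so both
  sums telescope as in the Christoffel--Darboux formula for orthogonal polynomials. The formula on
  the diagonal is usually obtained as the limit \<open>x' \<rightarrow> x\<close> followed by eliminating the derivatives.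
  Its right-hand side, a quadratic form in \<open>P n\<close> and \<open>P (n-1)\<close>, also telescopes directly by
  the recurrence, so no differentiation is needed.
\<close>

section \<open>Three-term recurrence\<close>

text \<open>The coefficient of \<open>((1 - x) / 2) ^ j\<close> in the series of the Ferrers function.\<close>

definition ferrers_coeff :: "complex \<Rightarrow> complex \<Rightarrow> nat \<Rightarrow> complex" where
  "ferrers_coeff \<nu> \<mu> j =
     pochhammer (- \<nu>) j * pochhammer (\<nu> + 1) j * rGamma (\<mu> + 1 + of_nat j) / fact j"

lemma ferrers_coeff_Suc:
  "(\<mu> + 1 + of_nat j) * of_nat (Suc j) * ferrers_coeff \<nu> \<mu> (Suc j) =
     (of_nat j - \<nu>) * (of_nat j + \<nu> + 1) * ferrers_coeff \<nu> \<mu> j"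
proof -
  define r where "r = rGamma (\<mu> + 1 + of_nat (Suc j))"
  have r: "rGamma (\<mu> + 1 + of_nat j) = (\<mu> + 1 + of_nat j) * r"
    using rGamma_plus1[of "\<mu> + 1 + of_nat j"] unfolding r_def by (simp add: add_ac)
  define F :: complex where "F = fact j"
  have F: "fact (Suc j) = of_nat (Suc j) * F" "F \<noteq> 0" by (simp_all add: F_def)
  have s: "of_nat (Suc j) \<noteq> (0::complex)" by (rule of_nat_neq_0)
  show ?thesis
    unfolding ferrers_coeff_def r F(1) r_def[symmetric] F_def[symmetric] pochhammer_Suc
    using F(2) s by (simp add: divide_simps del: of_nat_Suc)
qed

lemma summable_ferrers_series:
  assumes "norm t < 1"
  shows "summable (\<lambda>j. ferrers_coeff \<nu> \<mu> j * t ^ j)"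
proof -
  \<comment> \<open>Ratio test. The ratio bound is kept in multiplied form, as the coefficients may vanish.\<close>
  obtain c where c: "norm t < c" "c < 1" using assms dense by blast
  have inf: "filterlim (\<lambda>j. b + of_nat j :: complex) at_infinity sequentially" for b
    by (rule tendsto_add_filterlim_at_infinity[OF tendsto_const tendsto_of_nat])
  have ne: "eventually (\<lambda>j. b + of_nat j \<noteq> (0::complex)) sequentially" for b
    by (rule filterlim_at_infinity_imp_eventually_ne[OF inf])
  have quot: "(\<lambda>j. (a + of_nat j) / (b + of_nat j) :: complex) \<longlonglongrightarrow> 1" for a b
  proof -
    have "(\<lambda>j. 1 + (a - b) / (b + of_nat j)) \<longlonglongrightarrow> 1 + 0"
      by (intro tendsto_add tendsto_const tendsto_divide_0[OF tendsto_const inf])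
    moreover have "eventually (\<lambda>j. 1 + (a - b) / (b + of_nat j) = (a + of_nat j) / (b + of_nat j))
        sequentially"
      using ne[of b] by eventually_elim (simp add: field_simps)
    ultimately show ?thesis by (simp add: tendsto_cong)
  qed
  define R where
    "R = (\<lambda>j. (- \<nu> + of_nat j) / (\<mu> + 1 + of_nat j) * ((\<nu> + 1 + of_nat j) / (1 + of_nat j)) * t)"
  have "R \<longlonglongrightarrow> 1 * 1 * t"
    unfolding R_def by (intro tendsto_mult quot tendsto_const)
  then have "(\<lambda>j. norm (R j)) \<longlonglongrightarrow> norm t" by (simp add: tendsto_norm)
  then have "eventually (\<lambda>j. norm (R j) < c) sequentially" using c(1) by (rule order_tendstoD)
  moreover note ne[of "\<mu> + 1"]
  ultimately have "eventually (\<lambda>j. norm (ferrers_coeff \<nu> \<mu> (Suc j) * t ^ Suc j)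
      \<le> c * norm (ferrers_coeff \<nu> \<mu> j * t ^ j)) sequentially"
  proof eventually_elim
    case (elim j)
    have s: "of_nat (Suc j) \<noteq> (0::complex)" by (rule of_nat_neq_0)
    have "ferrers_coeff \<nu> \<mu> (Suc j) * t ^ Suc j = R j * (ferrers_coeff \<nu> \<mu> j * t ^ j)"
      using ferrers_coeff_Suc[of \<mu> j \<nu>] elim(2) s
      by (simp add: R_def divide_simps) (simp add: algebra_simps)
    then show ?case
      using elim(1) by (simp add: norm_mult mult_right_mono del: power_Suc)
  qed
  then obtain N where "\<And>j. j \<ge> N \<Longrightarrow> norm (ferrers_coeff \<nu> \<mu> (Suc j) * t ^ Suc j)
      \<le> c * norm (ferrers_coeff \<nu> \<mu> j * t ^ j)"
    unfolding eventually_sequentially by blast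
  with c(2) show ?thesis by (rule summable_ratio_test)
qed

lemma ferrers_coeff_recurrence_0:
  "(\<nu> + \<mu> + 1) * ferrers_coeff (\<nu> + 1) \<mu> 0 =
     (2 * \<nu> + 1) * ferrers_coeff \<nu> \<mu> 0 - (\<nu> - \<mu>) * ferrers_coeff (\<nu> - 1) \<mu> 0"
  by (simp add: ferrers_coeff_def algebra_simps)

lemma ferrers_coeff_recurrence:
  "(\<nu> + \<mu> + 1) * ferrers_coeff (\<nu> + 1) \<mu> (Suc j) =
     (2 * \<nu> + 1) * (ferrers_coeff \<nu> \<mu> (Suc j) - 2 * ferrers_coeff \<nu> \<mu> j) -
     (\<nu> - \<mu>) * ferrers_coeff (\<nu> - 1) \<mu> (Suc j)"
proof (cases j)
  case 0
  have "rGamma (\<mu> + 1) = (\<mu> + 1) * rGamma (\<mu> + 1 + 1)" by (rule rGamma_plus1[symmetric])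
  then show ?thesis
    unfolding 0 by (simp add: ferrers_coeff_def) (simp add: algebra_simps)
next
  case (Suc m)
  \<comment> \<open>All four terms are multiples of \<open>A * B * r / F\<close>, since every Pochhammer symbol here
    consists of \<open>A\<close> or \<open>B\<close> and at most two further factors. For \<open>j = 0\<close> the symbols are too short
    for this.\<close>
  define A where "A = pochhammer (1 - \<nu>) m"
  define B where "B = pochhammer (\<nu> + 2) m"
  define M :: complex where "M = of_nat m"
  define r where "r = rGamma (\<mu> + 1 + of_nat (Suc (Suc m)))"
  define F :: complex where "F = fact (Suc m)"
  have F: "fact (Suc (Suc m)) = (M + 2) * F" "F \<noteq> 0"
    by (simp_all add: F_def M_def add_ac del: fact_Suc add: fact_Suc[of "Suc m"])
  have M2: "M + 2 \<noteq> 0"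
    using of_nat_neq_0[of "Suc m", where 'a = complex] by (simp add: M_def add_ac)
  have r: "rGamma (\<mu> + 1 + of_nat (Suc m)) = (\<mu> + M + 2) * r"
    using rGamma_plus1[of "\<mu> + 1 + of_nat (Suc m)"] unfolding r_def M_def by (simp add: add_ac)
  have poch:
    "pochhammer (- (\<nu> + 1)) (Suc (Suc m)) = (\<nu> + 1) * \<nu> * A"
    "pochhammer (\<nu> + 1 + 1) (Suc (Suc m)) = B * (\<nu> + 2 + M) * (\<nu> + 3 + M)"
    "pochhammer (- \<nu>) (Suc (Suc m)) = - \<nu> * A * (1 - \<nu> + M)"
    "pochhammer (\<nu> + 1) (Suc (Suc m)) = (\<nu> + 1) * B * (\<nu> + 2 + M)"
    "pochhammer (- (\<nu> - 1)) (Suc (Suc m)) = A * (1 - \<nu> + M) * (2 - \<nu> + M)"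
    "pochhammer (\<nu> - 1 + 1) (Suc (Suc m)) = \<nu> * (\<nu> + 1) * B"
    "pochhammer (- \<nu>) (Suc m) = - \<nu> * A"
    "pochhammer (\<nu> + 1) (Suc m) = (\<nu> + 1) * B"
  proof -
    have rec: "pochhammer z (Suc m) = z * pochhammer (z + 1) m"
      "pochhammer z (Suc (Suc m)) = z * (z + 1) * pochhammer (z + 2) m"
      "pochhammer z (Suc (Suc m)) = z * pochhammer (z + 1) m * (z + 1 + M)"
      "pochhammer z (Suc (Suc m)) = pochhammer z m * (z + M) * (z + 1 + M)"
      for z :: complex
      subgoal by (rule pochhammer_rec)
      subgoal by (simp add: pochhammer_rec add.assoc)
      subgoal using pochhammer_Suc[of z "Suc m"]
        by (simp add: pochhammer_rec[of z m] M_def add_ac)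
      subgoal by (simp add: pochhammer_Suc M_def add_ac)
      done
    show "pochhammer (- (\<nu> + 1)) (Suc (Suc m)) = (\<nu> + 1) * \<nu> * A"
      unfolding rec(2) by (simp add: A_def algebra_simps)
    show "pochhammer (\<nu> + 1 + 1) (Suc (Suc m)) = B * (\<nu> + 2 + M) * (\<nu> + 3 + M)"
      unfolding rec(4) by (simp add: B_def add_ac)
    show "pochhammer (- \<nu>) (Suc (Suc m)) = - \<nu> * A * (1 - \<nu> + M)"
      unfolding rec(3) by (simp add: A_def add_ac)
    show "pochhammer (\<nu> + 1) (Suc (Suc m)) = (\<nu> + 1) * B * (\<nu> + 2 + M)"
      unfolding rec(3) by (simp add: B_def add_ac)
    show "pochhammer (- (\<nu> - 1)) (Suc (Suc m)) = A * (1 - \<nu> + M) * (2 - \<nu> + M)"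
      unfolding rec(4) by (simp add: A_def algebra_simps)
    show "pochhammer (\<nu> - 1 + 1) (Suc (Suc m)) = \<nu> * (\<nu> + 1) * B"
      unfolding rec(2) by (simp add: B_def add_ac)
    show "pochhammer (- \<nu>) (Suc m) = - \<nu> * A"
      unfolding rec(1) by (simp add: A_def)
    show "pochhammer (\<nu> + 1) (Suc m) = (\<nu> + 1) * B"
      unfolding rec(1) by (simp add: B_def add_ac)
  qed
  show ?thesis
    unfolding Suc ferrers_coeff_def poch r r_def[symmetric] F(1) F_def[symmetric]
    using F(2) M2 by (simp add: divide_simps) (simp add: algebra_simps)
qed

lemma ferrers_P_neg_recurrence:
  assumes x: "x \<in> {-1<..<1::real}"
  shows "(\<nu> + \<mu> + 1) * ferrers_P_neg (\<nu> + 1) \<mu> x =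
    (2 * \<nu> + 1) * complex_of_real x * ferrers_P_neg \<nu> \<mu> x - (\<nu> - \<mu>) * ferrers_P_neg (\<nu> - 1) \<mu> x"
proof -
  define t where "t = complex_of_real ((1 - x) / 2)"
  have t: "norm t < 1" using x unfolding t_def norm_of_real by auto
  have xt: "complex_of_real x = 1 - 2 * t" by (simp add: t_def field_simps)
  define a where "a = (\<lambda>\<nu>' j. ferrers_coeff \<nu>' \<mu> j * t ^ j)"
  have a: "summable (a \<nu>')" for \<nu>'
    unfolding a_def by (rule summable_ferrers_series[OF t])
  have sh: "summable (\<lambda>j. a \<nu>' (Suc j))" for \<nu>'
    using a by (simp add: summable_Suc_iff)
  have a_rec: "(\<nu> + \<mu> + 1) * a (\<nu> + 1) (Suc j) =
      (2 * \<nu> + 1) * (a \<nu> (Suc j) - 2 * t * a \<nu> j) - (\<nu> - \<mu>) * a (\<nu> - 1) (Suc j)" for j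
    using arg_cong[OF ferrers_coeff_recurrence[of \<nu> \<mu> j], of "\<lambda>z. z * t ^ Suc j"]
    unfolding a_def by (simp add: algebra_simps)
  have tail: "(\<nu> + \<mu> + 1) * (\<Sum>j. a (\<nu> + 1) (Suc j)) =
      (2 * \<nu> + 1) * ((\<Sum>j. a \<nu> (Suc j)) - 2 * t * suminf (a \<nu>)) -
      (\<nu> - \<mu>) * (\<Sum>j. a (\<nu> - 1) (Suc j))"
  proof (rule sums_unique2)
    show "(\<lambda>j. (\<nu> + \<mu> + 1) * a (\<nu> + 1) (Suc j)) sums
        ((\<nu> + \<mu> + 1) * (\<Sum>j. a (\<nu> + 1) (Suc j)))"
      by (intro sums_mult summable_sums sh)
    show "(\<lambda>j. (\<nu> + \<mu> + 1) * a (\<nu> + 1) (Suc j)) sums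
        ((2 * \<nu> + 1) * ((\<Sum>j. a \<nu> (Suc j)) - 2 * t * suminf (a \<nu>)) -
         (\<nu> - \<mu>) * (\<Sum>j. a (\<nu> - 1) (Suc j)))"
      unfolding a_rec by (intro sums_diff sums_mult summable_sums sh a)
  qed
  have head: "(\<nu> + \<mu> + 1) * a (\<nu> + 1) 0 = (2 * \<nu> + 1) * a \<nu> 0 - (\<nu> - \<mu>) * a (\<nu> - 1) 0"
    using ferrers_coeff_recurrence_0 by (simp add: a_def)
  have split: "suminf (a \<nu>') = a \<nu>' 0 + (\<Sum>j. a \<nu>' (Suc j))" for \<nu>'
    using suminf_split_head[OF a, of \<nu>'] by simp
  have "(\<nu> + \<mu> + 1) * suminf (a (\<nu> + 1)) =
      (2 * \<nu> + 1) * a \<nu> 0 - (\<nu> - \<mu>) * a (\<nu> - 1) 0 +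
      ((2 * \<nu> + 1) * ((\<Sum>j. a \<nu> (Suc j)) - 2 * t * suminf (a \<nu>)) -
       (\<nu> - \<mu>) * (\<Sum>j. a (\<nu> - 1) (Suc j)))"
    unfolding split[of "\<nu> + 1"] distrib_left[of "\<nu> + \<mu> + 1"] head tail ..
  also have "\<dots> = (2 * \<nu> + 1) * (a \<nu> 0 + (\<Sum>j. a \<nu> (Suc j)) - 2 * t * suminf (a \<nu>)) -
      (\<nu> - \<mu>) * (a (\<nu> - 1) 0 + (\<Sum>j. a (\<nu> - 1) (Suc j)))"
    by (simp add: algebra_simps)
  also have "\<dots> = (2 * \<nu> + 1) * (1 - 2 * t) * suminf (a \<nu>) - (\<nu> - \<mu>) * suminf (a (\<nu> - 1))"
    unfolding split[symmetric] by (simp add: algebra_simps)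
  finally have S: "(\<nu> + \<mu> + 1) * suminf (a (\<nu> + 1)) =
      (2 * \<nu> + 1) * (1 - 2 * t) * suminf (a \<nu>) - (\<nu> - \<mu>) * suminf (a (\<nu> - 1))" .
  define w where "w = complex_of_real ((1 - x) / (1 + x)) powr (\<mu> / 2)"
  have P: "ferrers_P_neg \<nu>' \<mu> x = w * suminf (a \<nu>')" for \<nu>'
    by (simp add: ferrers_P_neg_def a_def ferrers_coeff_def t_def w_def mult_ac)
  show ?thesis
    using arg_cong[OF S, of "\<lambda>z. w * z"] unfolding P xt by (simp add: algebra_simps)
qed

section \<open>Christoffel--Darboux summation\<close>

text \<open>
  Solutions \<open>p\<close> and \<open>q\<close> of the recurrence at arguments \<open>x\<close> and \<open>y\<close>. For \<open>k = 0\<close> the truncated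
  index \<open>k - 1\<close> is harmless because the corresponding term carries the factor \<open>k\<close>.
\<close>

lemma christoffel_darboux:
  fixes p q w :: "nat \<Rightarrow> complex"
  assumes w: "\<And>k. of_nat (Suc k) * w (Suc k) = (of_nat k + 2 * \<mu> + 1) * w k"
    and p: "\<And>k. (of_nat k + 2 * \<mu> + 1) * p (Suc k) =
      (2 * of_nat k + 2 * \<mu> + 1) * x * p k - of_nat k * p (k - 1)"
    and q: "\<And>k. (of_nat k + 2 * \<mu> + 1) * q (Suc k) =
      (2 * of_nat k + 2 * \<mu> + 1) * y * q k - of_nat k * q (k - 1)"
  shows "(x - y) * (\<Sum>k<n. (2 * \<mu> + 2 * of_nat k + 1) * w k * p k * q k) =
    of_nat n * w n * (p n * q (n - 1) - p (n - 1) * q n)"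
proof (induction n)
  case 0
  show ?case by simp
next
  case (Suc n)
  have "of_nat (Suc n) * w (Suc n) * (p (Suc n) * q n - p n * q (Suc n)) =
      w n * (((of_nat n + 2 * \<mu> + 1) * p (Suc n)) * q n -
             p n * ((of_nat n + 2 * \<mu> + 1) * q (Suc n)))"
    unfolding w by (simp add: algebra_simps)
  also have "\<dots> = of_nat n * w n * (p n * q (n - 1) - p (n - 1) * q n) +
      (x - y) * ((2 * \<mu> + 2 * of_nat n + 1) * w n * p n * q n)"
    unfolding p q by (simp add: algebra_simps)
  finally show ?case
    using Suc by (simp add: distrib_left)
qed

lemma christoffel_darboux_diagonal:
  fixes p w :: "nat \<Rightarrow> complex"
  assumes w: "\<And>k. of_nat (Suc k) * w (Suc k) = (of_nat k + 2 * \<mu> + 1) * w k"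
    and p: "\<And>k. (of_nat k + 2 * \<mu> + 1) * p (Suc k) =
      (2 * of_nat k + 2 * \<mu> + 1) * x * p k - of_nat k * p (k - 1)"
  shows "(1 - x\<^sup>2) * (\<Sum>k<n. (2 * \<mu> + 2 * of_nat k + 1) * w k * (p k)\<^sup>2) =
    of_nat n * w n * ((of_nat n + 2 * \<mu>) * (p n)\<^sup>2 + of_nat n * (p (n - 1))\<^sup>2 -
      2 * x * (of_nat n + \<mu>) * p (n - 1) * p n)"
proof (induction n)
  case 0
  show ?case by simp
next
  case (Suc n)
  define N :: complex where "N = of_nat n"
  define a where "a = N + 2 * \<mu> + 1"
  have "of_nat (Suc n) * w (Suc n) * ((of_nat (Suc n) + 2 * \<mu>) * (p (Suc n))\<^sup>2 +
        of_nat (Suc n) * (p n)\<^sup>2 - 2 * x * (of_nat (Suc n) + \<mu>) * p n * p (Suc n)) =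
      w n * ((a * p (Suc n))\<^sup>2 + (N + 1) * a * (p n)\<^sup>2 -
        2 * x * (N + 1 + \<mu>) * p n * (a * p (Suc n)))"
    unfolding w by (simp add: a_def N_def algebra_simps power2_eq_square)
  also have "\<dots> = N * w n * ((N + 2 * \<mu>) * (p n)\<^sup>2 + N * (p (n - 1))\<^sup>2 -
        2 * x * (N + \<mu>) * p (n - 1) * p n) +
      (1 - x\<^sup>2) * ((2 * \<mu> + 2 * N + 1) * w n * (p n)\<^sup>2)"
    unfolding p[of n, folded N_def, folded a_def]
    by (simp add: a_def algebra_simps power2_eq_square)
  finally show ?case
    using Suc by (simp add: distrib_left N_def)
qed

theorem theorem3p13:
  fixes \<mu> :: complex and n :: nat
  assumes mu: "2 * \<mu> + 1 \<notin> \<int>\<^sub>\<le>\<^sub>0" and n: "n \<ge> 1"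
  shows "(\<forall>x \<in> {-1<..<1::real}. \<forall>x' \<in> {-1<..<1::real}. x \<noteq> x' \<longrightarrow>
      (\<Sum>k = 0..n-1.
          (2 * \<mu> + 2 * of_nat k + 1) * Gamma (2 * \<mu> + of_nat k + 1) / fact k *
          ferrers_P_neg (of_nat k + \<mu>) \<mu> x * ferrers_P_neg (of_nat k + \<mu>) \<mu> x') =
      Gamma (2 * \<mu> + of_nat n + 1) / (fact (n - 1) * complex_of_real (x - x')) *
        (ferrers_P_neg (of_nat n + \<mu>) \<mu> x * ferrers_P_neg (of_nat n + \<mu> - 1) \<mu> x' -
         ferrers_P_neg (of_nat n + \<mu> - 1) \<mu> x * ferrers_P_neg (of_nat n + \<mu>) \<mu> x'))
    \<and> (\<forall>x \<in> {-1<..<1::real}.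
      (\<Sum>k = 0..n-1.
          (2 * \<mu> + 2 * of_nat k + 1) * Gamma (2 * \<mu> + of_nat k + 1) / fact k *
          (ferrers_P_neg (of_nat k + \<mu>) \<mu> x)\<^sup>2) =
      Gamma (2 * \<mu> + of_nat n + 1) / (fact (n - 1) * complex_of_real (1 - x\<^sup>2)) *
        ((of_nat n + 2 * \<mu>) * (ferrers_P_neg (of_nat n + \<mu>) \<mu> x)\<^sup>2 +
         of_nat n * (ferrers_P_neg (of_nat n + \<mu> - 1) \<mu> x)\<^sup>2 -
         2 * complex_of_real x * (of_nat n + \<mu>) *
           ferrers_P_neg (of_nat n + \<mu> - 1) \<mu> x * ferrers_P_neg (of_nat n + \<mu>) \<mu> x))"
proof -
  define P where "P = (\<lambda>x k. ferrers_P_neg (of_nat k + \<mu>) \<mu> x)"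
  define w :: "nat \<Rightarrow> complex" where "w = (\<lambda>k. Gamma (2 * \<mu> + of_nat k + 1) / fact k)"
  have w: "of_nat (Suc k) * w (Suc k) = (of_nat k + 2 * \<mu> + 1) * w k" for k
  proof -
    have "2 * \<mu> + of_nat k + 1 \<notin> \<int>\<^sub>\<le>\<^sub>0"
      using mu nonpos_Ints_diff_Nats[of "2 * \<mu> + of_nat k + 1" "of_nat k"] by auto
    then have "Gamma (2 * \<mu> + of_nat (Suc k) + 1) =
        (2 * \<mu> + of_nat k + 1) * Gamma (2 * \<mu> + of_nat k + 1)"
      using Gamma_plus1[of "2 * \<mu> + of_nat k + 1"] by (simp add: add_ac)
    moreover have "of_nat (Suc k) \<noteq> (0::complex)" by (rule of_nat_neq_0)
    ultimately show ?thesis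
      unfolding w_def by (simp add: fact_Suc add_ac del: of_nat_Suc)
  qed
  have P: "(of_nat k + 2 * \<mu> + 1) * P x (Suc k) =
      (2 * of_nat k + 2 * \<mu> + 1) * complex_of_real x * P x k - of_nat k * P x (k - 1)"
    if "x \<in> {-1<..<1}" for x k
    using ferrers_P_neg_recurrence[OF that, of "of_nat k + \<mu>" \<mu>]
    by (cases k) (simp_all add: P_def algebra_simps)
  have wn: "Gamma (2 * \<mu> + of_nat n + 1) / (fact (n - 1) * D) = of_nat n * w n / D" for D
    using n by (cases n) (simp_all add: w_def divide_simps del: of_nat_Suc)
  have P1: "ferrers_P_neg (of_nat n + \<mu> - 1) \<mu> x = P x (n - 1)" for x
    using n by (simp add: P_def of_nat_diff algebra_simps)
  have ivl: "{0..n - 1} = {..<n}" using n by auto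
  have eq_divI: "S = W / D * Q" if "D * S = W * Q" "D \<noteq> 0" for S W D Q :: complex
    using that by (simp add: field_simps)
  have summand: "c * Gamma (2 * \<mu> + of_nat k + 1) / fact k = c * w k" for c k
    by (simp add: w_def)
  have "(\<Sum>k<n. (2 * \<mu> + 2 * of_nat k + 1) * w k * P x k * P x' k) =
      of_nat n * w n / complex_of_real (x - x') * (P x n * P x' (n - 1) - P x (n - 1) * P x' n)"
    if "x \<in> {-1<..<1}" "x' \<in> {-1<..<1}" "x \<noteq> x'" for x x'
  proof (rule eq_divI)
    show "complex_of_real (x - x') * (\<Sum>k<n. (2 * \<mu> + 2 * of_nat k + 1) * w k * P x k * P x' k) =
        of_nat n * w n * (P x n * P x' (n - 1) - P x (n - 1) * P x' n)"
      unfolding of_real_diff by (rule christoffel_darboux[OF w P[OF that(1)] P[OF that(2)]])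
    show "complex_of_real (x - x') \<noteq> 0" using that(3) by simp
  qed
  moreover have "(\<Sum>k<n. (2 * \<mu> + 2 * of_nat k + 1) * w k * (P x k)\<^sup>2) =
      of_nat n * w n / complex_of_real (1 - x\<^sup>2) *
        ((of_nat n + 2 * \<mu>) * (P x n)\<^sup>2 + of_nat n * (P x (n - 1))\<^sup>2 -
         2 * complex_of_real x * (of_nat n + \<mu>) * P x (n - 1) * P x n)"
    if "x \<in> {-1<..<1}" for x
  proof (rule eq_divI)
    show "complex_of_real (1 - x\<^sup>2) * (\<Sum>k<n. (2 * \<mu> + 2 * of_nat k + 1) * w k * (P x k)\<^sup>2) =
        of_nat n * w n * ((of_nat n + 2 * \<mu>) * (P x n)\<^sup>2 + of_nat n * (P x (n - 1))\<^sup>2 -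
          2 * complex_of_real x * (of_nat n + \<mu>) * P x (n - 1) * P x n)"
      unfolding of_real_diff of_real_power of_real_1
      by (rule christoffel_darboux_diagonal[OF w P[OF that]])
    show "complex_of_real (1 - x\<^sup>2) \<noteq> 0"
      using that abs_square_less_1[of x] unfolding of_real_eq_0_iff by auto
  qed
  ultimately show ?thesis
    unfolding wn P1 ivl summand P_def by blast
qed

end
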